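(* Fix $n_0\ge 1$. Let $X_0$ be a planar polynomial vector field of degree $\le n_0$ having $k_0$ limit cycles. Let $X$ be any planar polynomial vector field of degree $N$ obtained from $X_0$ by a finite sequence of separable polynomial pullbacks $(u,v)\mapsto(p(u),p(v))$ with $\deg(p)\ge 2$ (the polynomial $p$ may change from step to step), assuming that at each step no limit cycles are created beyond the lifted copies forced by the full-branch structure of the pullback. Then $$\pi(X)\le k_0\left(\frac{N+1}{n_0+1}\right)^{2}.$$ In particular, any such replication-only scheme yields at most $O(N^2)$ limit cycles as $N\to\infty$.
   Context: A planar polynomial vector field is $X=(P,Q)$ with $P,Q\in\mathbb{R}[x,y]$, defining the system $\dot x=P(x,y)$, $\dot y=Q(x,y)$ on $\mathbb{R}^2$. Its degree is $\deg(X)=\max\{\deg P,\deg Q\}$ (total degree). A periodic orbit is a non-equilibrium closed trajectory of the flow; a limit cycle is a periodic orbit that is isolated among periodic orbits. $\pi(X)$ denotes the number of limit cycles of $X$. Separable pullback: for $p\in\mathbb{R}[x]$ and $X=(P,Q)$, put $\Phi(u,v)=(p(u),p(v))$. The separable pullback of $X$ by $p$ is the polynomial vector field $$\dot u=p'(v)\,P(p(u),p(v)),\qquad \dot v=p'(u)\,Q(p(u),p(v)).$$ Full branches: a full branch interval for $p$ is an open interval $I\subset\mathbb{R}$ such that $p:I\to(-1,1)$ is a $C^1$ diffeomorphism (onto). If $I_a,I_b$ are full branch intervals of $p$, then $\Phi$ restricts to a diffeomorphism of $I_a\times I_b$ onto $(-1,1)^2$. Lifted copies: for a limit cycle $\gamma\subset(-1,1)^2$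 of $X$, the lifted copies of $\gamma$ forced by the full-branch structure are the closed curves $\Phi^{-1}(\gamma)\cap(I_a\times I_b)$, one for each pair of full branch intervals $I_a,I_b$ of $p$; they are limit cycles of the separable pullback. The hypothesis that no limit cycles are created beyond these means that, at each step, the limit cycles of the new vector field are only lifted copies of limit cycles of the previous one.
   Formalization: In the first bound N is the degree of X when X0 is counted as having degree n0 (N+1 = (n0+1) times the product of the deg p), equal to the exact degree of X if deg X0 = n0; with exact degree and deg X0 < n0 the bound fails (no pullbacks, deg X0 = 3, k0 = 1, n0 = 4). *)

theory Defs
  imports "HOL-Analysis.Analysis" "HOL-Computational_Algebra.Polynomial"
begin

(* An element of R[x,y] is a real poly poly, read as R[x][y]: the coefficient of x^i y^j in P is
   coeff (coeff P j) i. *)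

definition eval2 :: "real poly poly \<Rightarrow> real \<Rightarrow> real \<Rightarrow> real" where
  "eval2 P x y = poly (poly P [:y:]) x"

(* The zero polynomial gets total degree 0. *)
definition total_degree :: "real poly poly \<Rightarrow> nat" where
  "total_degree P = Max (insert 0 {i + j | i j. coeff (coeff P j) i \<noteq> 0})"

definition poly_in_x :: "real poly \<Rightarrow> real poly poly" where
  "poly_in_x q = [:q:]"

definition poly_in_y :: "real poly \<Rightarrow> real poly poly" where
  "poly_in_y q = map_poly (\<lambda>a. [:a:]) q"

(* P(p(x), p(y)): compose every coefficient with p, then replace the outer variable y by p(y). *)
definition subst2 :: "real poly \<Rightarrow> real poly poly \<Rightarrow> real poly poly" where
  "subst2 p P = pcompose (map_poly (\<lambda>c. pcompose c p) P) (poly_in_y p)"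

type_synonym planar_field = "real poly poly \<times> real poly poly"

definition vf :: "planar_field \<Rightarrow> real \<times> real \<Rightarrow> real \<times> real" where
  "vf X z = (eval2 (fst X) (fst z) (snd z), eval2 (snd X) (fst z) (snd z))"

definition vf_degree :: "planar_field \<Rightarrow> nat" where
  "vf_degree X = max (total_degree (fst X)) (total_degree (snd X))"

definition periodic_orbit :: "planar_field \<Rightarrow> (real \<times> real) set \<Rightarrow> bool" where
  "periodic_orbit X \<gamma> \<longleftrightarrow>
     (\<exists>\<phi> T. T > 0 \<and>
        (\<forall>t. (\<phi> has_vector_derivative vf X (\<phi> t)) (at t)) \<and>
        (\<forall>t. \<phi> (t + T) = \<phi> t) \<and>
        vf X (\<phi> 0) \<noteq> 0 \<and>
        \<gamma> = range \<phi>)"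

definition limit_cycles :: "planar_field \<Rightarrow> (real \<times> real) set set" where
  "limit_cycles X =
     {\<gamma>. periodic_orbit X \<gamma> \<and>
         (\<exists>U. open U \<and> \<gamma> \<subseteq> U \<and> (\<forall>\<gamma>'. periodic_orbit X \<gamma>' \<and> \<gamma>' \<subseteq> U \<longrightarrow> \<gamma>' = \<gamma>))}"

(* Meaningful only together with finiteness of limit_cycles X. *)
definition num_limit_cycles :: "planar_field \<Rightarrow> nat" where
  "num_limit_cycles X = card (limit_cycles X)"

definition sep_pullback :: "real poly \<Rightarrow> planar_field \<Rightarrow> planar_field" where
  "sep_pullback p X =
     (poly_in_y (pderiv p) * subst2 p (fst X), poly_in_x (pderiv p) * subst2 p (snd X))"

definition sep_map :: "real poly \<Rightarrow> real \<times> real \<Rightarrow> real \<times> real" where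
  "sep_map p w = (poly p (fst w), poly p (snd w))"

definition full_branch :: "real poly \<Rightarrow> real set \<Rightarrow> bool" where
  "full_branch p I \<longleftrightarrow>
     open I \<and> is_interval I \<and>
     bij_betw (poly p) I {-1<..<1} \<and>
     poly p C1_differentiable_on I \<and>
     inv_into I (poly p) C1_differentiable_on {-1<..<1}"

definition lifted_copies :: "real poly \<Rightarrow> planar_field \<Rightarrow> (real \<times> real) set set" where
  "lifted_copies p X =
     {sep_map p -` \<gamma> \<inter> (I \<times> J) | \<gamma> I J.
        \<gamma> \<in> limit_cycles X \<and> \<gamma> \<subseteq> {-1<..<1} \<times> {-1<..<1} \<and> full_branch p I \<and> full_branch p J}"

(* replication_scheme X0 ps X: pulling back X0 successively by the polynomials in ps (head first)
   gives X, and no step creates limit cycles other than lifted copies. *)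
inductive replication_scheme :: "planar_field \<Rightarrow> real poly list \<Rightarrow> planar_field \<Rightarrow> bool"
  for X0 where
  start: "replication_scheme X0 [] X0"
| step: "replication_scheme X0 ps X \<Longrightarrow> 2 \<le> degree p \<Longrightarrow>
         limit_cycles (sep_pullback p X) \<subseteq> lifted_copies p X \<Longrightarrow>
         replication_scheme X0 (ps @ [p]) (sep_pullback p X)"

(* Degree bookkeeping: a field counted in degree n is, after pullback by p, counted in degree
   deg p * n + (deg p - 1), the first term from P(p(u),p(v)), the second from the factor p'. *)
definition scheme_degree :: "nat \<Rightarrow> real poly list \<Rightarrow> nat" where
  "scheme_degree n ps = fold (\<lambda>p m. degree p * m + (degree p - 1)) ps n"

lemma eval2_poly_in_x [simp]: "eval2 (poly_in_x q) x y = poly q x"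
  by (simp add: eval2_def poly_in_x_def)

lemma poly_poly_in_y: "poly (poly_in_y q) [:y:] = [:poly q y:]"
  unfolding poly_in_y_def by (induction q) (simp_all add: map_poly_pCons algebra_simps)

lemma eval2_poly_in_y [simp]: "eval2 (poly_in_y q) x y = poly q y"
  by (simp add: eval2_def poly_poly_in_y)

lemma eval2_mult [simp]: "eval2 (P * Q) x y = eval2 P x y * eval2 Q x y"
  by (simp add: eval2_def)

lemma eval2_subst2 [simp]: "eval2 (subst2 p P) u v = eval2 P (poly p u) (poly p v)"
proof -
  have "poly (poly (map_poly (\<lambda>c. pcompose c p) P) [:w:]) u = poly (poly P [:w:]) (poly p u)" for w
    by (induction P) (simp_all add: map_poly_pCons poly_pcompose)
  then show ?thesis
    by (simp add: eval2_def subst2_def poly_pcompose poly_poly_in_y)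
qed

lemma vf_sep_pullback:
  "vf (sep_pullback p (P, Q)) (u, v) =
     (poly (pderiv p) v * eval2 P (poly p u) (poly p v),
      poly (pderiv p) u * eval2 Q (poly p u) (poly p v))"
  by (simp add: vf_def sep_pullback_def)

end

theory Submission
  imports Defs
begin

text \<open>
  A full branch interval of \<open>p\<close> is a connected component of \<open>{x. \<bar>p x\<bar> < 1}\<close> and contains a root of
  \<open>p\<close>, so \<open>p\<close> has at most \<open>d = deg p\<close> of them and one pullback step multiplies the number of limit
  cycles by at most \<open>d\<^sup>2\<close>. The same step turns degree \<open>n\<close> into \<open>d n + d - 1\<close>, that is, it multiplies
  \<open>n + 1\<close> by \<open>d\<close>; hence the number of limit cycles divided by \<open>(n + 1)\<^sup>2\<close> never increases.
\<close>

section \<open>Total degree of a separable pullback\<close>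

lemma finite_total_degree_set: "finite {i + j | i j. coeff (coeff P j) i \<noteq> 0}"
proof -
  have "{i + j | i j. coeff (coeff P j) i \<noteq> 0}
      \<subseteq> (\<lambda>(j, i). i + j) ` (SIGMA j:{..degree P}. {..degree (coeff P j)})"
  proof safe
    fix i j assume nz: "coeff (coeff P j) i \<noteq> 0"
    then have "j \<le> degree P" "i \<le> degree (coeff P j)"
      by (auto intro: le_degree)
    then show "i + j \<in> (\<lambda>(j, i). i + j) ` (SIGMA j:{..degree P}. {..degree (coeff P j)})"
      by force
  qed
  then show ?thesis
    by (rule finite_subset) auto
qed

lemma total_degree_le_iff:
  "total_degree P \<le> n \<longleftrightarrow> (\<forall>i j. coeff (coeff P j) i \<noteq> 0 \<longrightarrow> i + j \<le> n)"
  unfolding total_degree_def using finite_total_degree_set[of P] by (subst Max_le_iff) auto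

lemma le_total_degree: "coeff (coeff P j) i \<noteq> 0 \<Longrightarrow> i + j \<le> total_degree P"
  using total_degree_le_iff by blast

lemma total_degree_0 [simp]: "total_degree 0 = 0"
  by (simp add: total_degree_def)

lemma total_degree_attained:
  assumes "P \<noteq> 0"
  obtains i j where "coeff (coeff P j) i \<noteq> 0" "i + j = total_degree P"
proof -
  have "total_degree P \<in> insert 0 {i + j | i j. coeff (coeff P j) i \<noteq> 0}"
    unfolding total_degree_def using finite_total_degree_set[of P] by (intro Max_in) auto
  \<comment> \<open>If the maximum is the inserted 0, \<open>le_total_degree\<close> forces
    \<open>i0 + j0 = 0\<close>, so this coefficient itself is the witness.\<close>
  moreover obtain i0 j0 where 0: "coeff (coeff P j0) i0 \<noteq> 0"
    using assms by (metis leading_coeff_0_iff)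
  ultimately show ?thesis
    using that le_total_degree[OF 0] 0 by force
qed

lemma coeff_poly_in_x_mult_poly_in_y:
  "coeff (coeff (poly_in_x q * poly_in_y r) b) a = coeff q a * coeff r b"
  by (simp add: poly_in_x_def poly_in_y_def coeff_map_poly mult.commute)

lemma poly_in_y_mult: "poly_in_y (p * q) = poly_in_y p * poly_in_y q"
  by (intro poly_eqI)
     (simp add: poly_in_y_def coeff_map_poly coeff_mult ac_simps flip: sum_to_poly)

lemma poly_in_y_1 [simp]: "poly_in_y 1 = 1"
  by (simp add: poly_in_y_def one_pCons map_poly_pCons)

lemma poly_in_y_power: "poly_in_y (p ^ n) = poly_in_y p ^ n"
  by (induction n) (simp_all add: poly_in_y_mult)

lemma poly_in_x_mult: "poly_in_x (p * q) = poly_in_x p * poly_in_x q"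
  by (simp add: poly_in_x_def)

lemma pcompose_conv_sum:
  fixes p q :: "'a :: comm_ring_1 poly"
  shows "pcompose p q = (\<Sum>i\<le>degree p. smult (coeff p i) (q ^ i))"
  by (simp add: pcompose_altdef poly_altdef coeff_map_poly degree_map_poly)

text \<open>Separates the variables: each summand is a polynomial in x alone times one in y alone,
  so its coefficients factor.\<close>

lemma subst2_conv_sum:
  "subst2 p P = (\<Sum>j\<le>degree P. poly_in_x (pcompose (coeff P j) p) * poly_in_y (p ^ j))"
proof -
  have "pcompose (map_poly (\<lambda>c. pcompose c p) P) R
      = (\<Sum>j\<le>degree P. smult (pcompose (coeff P j) p) (R ^ j))" for R
  proof -
    \<comment> \<open>The degree can drop, since composing with a constant \<open>p\<close> may kill
      a nonzero coefficient. The sum is therefore extended to \<open>degree P\<close> by zero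
      terms.\<close>
    have "degree (map_poly (\<lambda>c. pcompose c p) P) \<le> degree P"
      by (rule map_poly_degree_leq)
    then show ?thesis
      unfolding pcompose_conv_sum[of "map_poly (\<lambda>c. pcompose c p) P"]
      by (intro sum.mono_neutral_cong_left) (auto simp: coeff_map_poly intro!: le_degree)
  qed
  then show ?thesis
    by (simp add: subst2_def poly_in_x_def poly_in_y_power)
qed

lemma coeff_weighted_subst2:
  "coeff (coeff (poly_in_x q * poly_in_y r * subst2 p P) b) a =
     (\<Sum>j\<le>degree P. \<Sum>i\<le>degree (coeff P j).
        coeff (coeff P j) i * coeff (q * p ^ i) a * coeff (r * p ^ j) b)"
proof -
  have "poly_in_x q * poly_in_y r * subst2 p P =
    (\<Sum>j\<le>degree P. poly_in_x (q * pcompose (coeff P j) p) * poly_in_y (r * p ^ j))"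
    by (simp add: subst2_conv_sum sum_distrib_left poly_in_x_mult poly_in_y_mult ac_simps)
  then show ?thesis
    by (simp add: coeff_sum coeff_poly_in_x_mult_poly_in_y pcompose_conv_sum sum_distrib_left
        sum_distrib_right)
qed

text \<open>A monomial \<open>x^i y^j\<close> of \<open>P\<close> becomes a multiple of
  \<open>q(x) p(x)^i r(y) p(y)^j\<close>, with top bidegree
  \<open>(degree q + degree p * i, degree r + degree p * j)\<close>. These bidegrees are distinct
  for distinct monomials. The weights \<open>(q, r)\<close> serve both components of the pullback:
  \<open>(1, p')\<close> for the first and \<open>(p', 1)\<close> for the second.\<close>

lemma total_degree_weighted_subst2:
  assumes "P \<noteq> 0" "q \<noteq> 0" "r \<noteq> 0" and p: "degree p > 0"
  shows "total_degree (poly_in_x q * poly_in_y r * subst2 p P) =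
           degree q + degree r + degree p * total_degree P"
    (is "total_degree ?S = ?D")
proof (rule antisym)
  have p0: "p \<noteq> 0" using p by auto
  have deg: "degree (s * p ^ k) = degree s + degree p * k" if "s \<noteq> 0" for s k
    using that p0 by (simp add: degree_mult_eq degree_power_eq)
  have low: "a \<le> degree s + degree p * k" if "coeff (s * p ^ k) a \<noteq> 0" "s \<noteq> 0" for s a k
    using le_degree[OF that(1)] that(2) deg by simp
  have top: "coeff (s * p ^ k) (degree s + degree p * k) \<noteq> 0" if "s \<noteq> 0" for s k
    using that p0 deg[OF that, of k] by (metis leading_coeff_0_iff mult_eq_0_iff power_not_zero)
  show "total_degree ?S \<le> ?D"
    unfolding total_degree_le_iff
  proof (intro allI impI)
    fix a b assume "coeff (coeff ?S b) a \<noteq> 0"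
    then obtain i j where nz: "coeff (coeff P j) i * coeff (q * p ^ i) a * coeff (r * p ^ j) b \<noteq> 0"
      unfolding coeff_weighted_subst2 by (metis (no_types, lifting) sum.not_neutral_contains_not_neutral)
    then have "a + b \<le> degree q + degree r + degree p * (i + j)"
      using low[of q i a] low[of r j b] assms by (simp add: algebra_simps)
    also have "\<dots> \<le> ?D"
      using nz le_total_degree[of P j i] by simp
    finally show "a + b \<le> ?D" .
  qed
  obtain i j where ij: "coeff (coeff P j) i \<noteq> 0" "i + j = total_degree P"
    using total_degree_attained[OF \<open>P \<noteq> 0\<close>] .
  define a b where "a = degree q + degree p * i" and "b = degree r + degree p * j"
  define t where "t j' i' = coeff (coeff P j') i' * coeff (q * p ^ i') a * coeff (r * p ^ j') b"
    for i' j'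
  \<comment> \<open>A contributing \<open>(i', j')\<close> dominates \<open>(i, j)\<close>, which has maximal total degree, so no
    cancellation can occur at \<open>x\<^sup>a y\<^sup>b\<close>.\<close>
  have unique: "i' = i \<and> j' = j" if "t j' i' \<noteq> 0" for i' j'
  proof -
    have "a \<le> degree q + degree p * i'" "b \<le> degree r + degree p * j'" "i' + j' \<le> i + j"
      using that low[of q i' a] low[of r j' b] assms le_total_degree[of P j' i'] ij
      by (auto simp: t_def)
    then show ?thesis
      using p by (auto simp: a_def b_def)
  qed
  have bounds: "j \<le> degree P" "i \<le> degree (coeff P j)"
    using ij by (auto intro: le_degree)
  have "coeff (coeff ?S b) a = (\<Sum>j'\<le>degree P. \<Sum>i'\<le>degree (coeff P j'). t j' i')"
    by (simp add: coeff_weighted_subst2 t_def)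
  also have "\<dots> = (\<Sum>i'\<le>degree (coeff P j). t j i')"
    using unique bounds by (subst sum.mono_neutral_right[of _ "{j}"]) (auto intro!: sum.neutral)
  also have "\<dots> = t j i"
    using unique bounds by (subst sum.mono_neutral_right[of _ "{i}"]) auto
  also have "t j i \<noteq> 0"
    using ij(1) top[of q i] top[of r j] assms by (simp add: t_def a_def b_def)
  finally have "a + b \<le> total_degree ?S"
    by (rule le_total_degree)
  then show "?D \<le> total_degree ?S"
    by (simp add: a_def b_def flip: ij(2)) (simp add: algebra_simps)
qed

lemma subst2_0 [simp]: "subst2 p 0 = 0"
  by (simp add: subst2_def)

lemma sep_pullback_components:
  assumes "2 \<le> degree p"
  shows "total_degree (fst (sep_pullback p X)) =
           (if fst X = 0 then 0 else degree p * total_degree (fst X) + (degree p - 1))"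
    and "total_degree (snd (sep_pullback p X)) =
           (if snd X = 0 then 0 else degree p * total_degree (snd X) + (degree p - 1))"
    and "fst X \<noteq> 0 \<Longrightarrow> fst (sep_pullback p X) \<noteq> 0"
    and "snd X \<noteq> 0 \<Longrightarrow> snd (sep_pullback p X) \<noteq> 0"
proof -
  have dp: "pderiv p \<noteq> 0" "degree (pderiv p) = degree p - 1" "degree p > 0"
    using assms by (auto simp: pderiv_eq_0_iff degree_pderiv)
  have x1: "poly_in_x 1 = 1"
    by (simp add: poly_in_x_def)
  show 1: "total_degree (fst (sep_pullback p X)) =
           (if fst X = 0 then 0 else degree p * total_degree (fst X) + (degree p - 1))"
    using total_degree_weighted_subst2[of "fst X" 1 "pderiv p" p] dp
    by (simp add: sep_pullback_def x1 add.commute)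
  show 2: "total_degree (snd (sep_pullback p X)) =
           (if snd X = 0 then 0 else degree p * total_degree (snd X) + (degree p - 1))"
    using total_degree_weighted_subst2[of "snd X" "pderiv p" 1 p] dp
    by (simp add: sep_pullback_def add.commute)
  \<comment> \<open>By the formula just shown, the total degree is at least
    \<open>degree p - 1\<close>, hence positive, whereas 0 has total degree 0.\<close>
  show "fst (sep_pullback p X) \<noteq> 0" if "fst X \<noteq> 0"
    using 1 that assms by auto
  show "snd (sep_pullback p X) \<noteq> 0" if "snd X \<noteq> 0"
    using 2 that assms by auto
qed

text \<open>A single zero component is harmless: it contributes 0 to the maximum before and after
  the pullback. The zero field is excluded because it stays zero, while the formula would give
  \<open>degree p - 1\<close>.\<close>

lemma vf_degree_sep_pullback:
  assumes "2 \<le> degree p" "X \<noteq> 0"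
  shows "vf_degree (sep_pullback p X) = degree p * vf_degree X + (degree p - 1)"
    and "sep_pullback p X \<noteq> 0"
proof -
  have "fst X \<noteq> 0 \<or> snd X \<noteq> 0"
    using assms(2) by (simp add: prod_eq_iff)
  then show "vf_degree (sep_pullback p X) = degree p * vf_degree X + (degree p - 1)"
    using sep_pullback_components(1,2)[OF assms(1), of X]
    by (auto simp: vf_degree_def max_def)
  show "sep_pullback p X \<noteq> 0"
    using \<open>fst X \<noteq> 0 \<or> snd X \<noteq> 0\<close> sep_pullback_components(3,4)[OF assms(1), of X]
    by (auto simp: prod_eq_iff)
qed

lemma sep_pullback_0: "sep_pullback p 0 = 0"
  by (simp add: sep_pullback_def prod_eq_iff)

section \<open>Counting full branches and lifted copies\<close>

text \<open>\<open>I\<close> is connected, open, and relatively closed in the set where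
  \<open>|p x| < 1\<close>. Hence a full branch is determined by any one of its points, which
  permits counting branches by roots.\<close>

lemma full_branch_eq_component:
  assumes I: "full_branch p I" and "r \<in> I"
  shows "I = connected_component_set {x. poly p x \<in> {-1<..<1}} r"
proof -
  let ?V = "{x. poly p x \<in> {-1<..<1}}"
  have "open I" and bij: "bij_betw (poly p) I {-1<..<1}"
    and inv: "continuous_on {-1<..<1} (inv_into I (poly p))" and "connected I"
    using I by (auto simp: full_branch_def intro: C1_differentiable_imp_continuous_on
        is_interval_connected)
  have sub: "I \<subseteq> ?V"
    using bij by (auto simp: bij_betw_def)
  \<comment> \<open>Continuity of the inverse branch makes \<open>I\<close> closed relative to \<open>{x. \<bar>p x\<bar> < 1}\<close>.\<close>
  have "x \<in> I" if x: "x \<in> ?V" "x \<in> closure I" for x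
  proof -
    obtain s where s: "\<And>n. s n \<in> I" "s \<longlonglongrightarrow> x"
      using x(2) unfolding closure_sequential by blast
    have "(\<lambda>n. poly p (s n)) \<longlonglongrightarrow> poly p x"
      by (intro tendsto_intros s)
    \<comment> \<open>The limit \<open>poly p x\<close> still lies in the open interval on which the
      inverse branch is continuous, because \<open>x\<close> is in \<open>?V\<close>.\<close>
    then have "(\<lambda>n. inv_into I (poly p) (poly p (s n))) \<longlonglongrightarrow> inv_into I (poly p) (poly p x)"
      using x(1) sub s(1) by (intro continuous_on_tendsto_compose[OF inv] always_eventually) auto
    then have "s \<longlonglongrightarrow> inv_into I (poly p) (poly p x)"
      using bij s(1) by (simp add: bij_betw_def)
    then have "x = inv_into I (poly p) (poly p x)"
      using s(2) LIMSEQ_unique by blast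
    moreover have "inv_into I (poly p) (poly p x) \<in> I"
      using bij x(1) by (intro inv_into_into) (auto simp: bij_betw_def)
    ultimately show ?thesis by simp
  qed
  then have closed: "I = ?V \<inter> closure I"
    using sub closure_subset by blast
  let ?C = "connected_component_set ?V r"
  have "I \<subseteq> ?C"
    using sub \<open>connected I\<close> \<open>r \<in> I\<close> by (intro connected_component_maximal) auto
  moreover have "?C \<subseteq> I"
  proof -
    have CV: "?C \<subseteq> ?V"
      by (rule connected_component_subset)
    have "connected ?C"
      by simp
    moreover have "openin (top_of_set ?C) (?C \<inter> I)"
      using \<open>open I\<close> by auto
    moreover have "closedin (top_of_set ?C) (?C \<inter> I)"
    proof -
      have "?C \<inter> I = ?C \<inter> closure I"
        using CV closed by blast
      then show ?thesis
        by (simp add: closedin_closed_Int)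
    qed
    ultimately have "?C \<inter> I = {} \<or> ?C \<inter> I = ?C"
      unfolding connected_clopen by blast
    then show ?thesis
      using \<open>I \<subseteq> ?C\<close> \<open>r \<in> I\<close> by blast
  qed
  ultimately show ?thesis by (rule subset_antisym)
qed

text \<open>Every full branch takes the value 0, so sending each root of \<open>p\<close> to its
  component reaches all full branches.\<close>

lemma card_full_branches:
  assumes "p \<noteq> 0"
  shows "finite {I. full_branch p I}" and "card {I. full_branch p I} \<le> degree p"
proof -
  let ?f = "connected_component_set {x. poly p x \<in> {-1<..<1}}"
  have sub: "{I. full_branch p I} \<subseteq> ?f ` {x. poly p x = 0}"
  proof safe
    fix I assume I: "full_branch p I"
    then have "0 \<in> poly p ` I"
      by (auto simp: full_branch_def bij_betw_def)
    then obtain r where "r \<in> I" "poly p r = 0"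
      by auto
    then show "I \<in> ?f ` {x. poly p x = 0}"
      using full_branch_eq_component[OF I] by blast
  qed
  have fin: "finite {x. poly p x = 0}"
    using assms by (rule poly_roots_finite)
  show "finite {I. full_branch p I}"
    using sub fin finite_surj by blast
  have "card {I. full_branch p I} \<le> card {x. poly p x = 0}"
    using sub fin by (rule surj_card_le[rotated])
  also have "\<dots> \<le> degree p"
    using assms by (rule card_poly_roots_bound)
  finally show "card {I. full_branch p I} \<le> degree p" .
qed

lemma card_lifted_copies:
  assumes "finite (limit_cycles X)" "p \<noteq> 0"
  shows "finite (lifted_copies p X)"
    and "card (lifted_copies p X) \<le> card (limit_cycles X) * (degree p)\<^sup>2"
proof -
  let ?B = "{I. full_branch p I}"
  let ?D = "limit_cycles X \<times> ?B \<times> ?B"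
  let ?f = "\<lambda>(\<gamma>, I, J). sep_map p -` \<gamma> \<inter> (I \<times> J)"
  have sub: "lifted_copies p X \<subseteq> ?f ` ?D"
    unfolding lifted_copies_def by force
  have fin: "finite ?D"
    using assms card_full_branches(1) by blast
  show "finite (lifted_copies p X)"
    using sub fin finite_surj by blast
  have "card (lifted_copies p X) \<le> card ?D"
    using sub fin by (rule surj_card_le[rotated])
  also have "\<dots> = card (limit_cycles X) * (card ?B)\<^sup>2"
    by (simp add: card_cartesian_product power2_eq_square)
  also have "\<dots> \<le> card (limit_cycles X) * (degree p)\<^sup>2"
    using card_full_branches(2)[OF assms(2)] by (intro mult_left_mono power_mono) auto
  finally show "card (lifted_copies p X) \<le> card (limit_cycles X) * (degree p)\<^sup>2" .
qed

section \<open>Replication schemes\<close>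

lemma scheme_degree_Nil [simp]: "scheme_degree n [] = n"
  by (simp add: scheme_degree_def)

lemma scheme_degree_snoc [simp]:
  "scheme_degree n (ps @ [p]) = degree p * scheme_degree n ps + (degree p - 1)"
  by (simp add: scheme_degree_def)

lemma scheme_degree_mono: "m \<le> n \<Longrightarrow> scheme_degree m ps \<le> scheme_degree n ps"
  by (induction ps rule: rev_induct) simp_all

text \<open>Here \<open>n\<close> is any nominal starting degree, not tied to \<open>X0\<close>; the
  final theorem uses both \<open>n0\<close> and \<open>vf_degree X0\<close>. Finiteness is carried
  through the induction because \<open>card\<close> is 0 on infinite sets. Clearing denominators
  keeps the invariant in the naturals.\<close>

lemma replication_scheme_limit_cycles:
  assumes "replication_scheme X0 ps X" "finite (limit_cycles X0)"
  shows "finite (limit_cycles X) \<and>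
    num_limit_cycles X * (n + 1)\<^sup>2 \<le> num_limit_cycles X0 * (scheme_degree n ps + 1)\<^sup>2"
  using assms(1)
proof induction
  case start
  show ?case using assms(2) by simp
next
  case (step ps X p)
  have "p \<noteq> 0" using step.hyps(2) by auto
  note lift = card_lifted_copies[OF conjunct1[OF step.IH] this]
  let ?N = "scheme_degree n ps"
  have "num_limit_cycles (sep_pullback p X) \<le> num_limit_cycles X * (degree p)\<^sup>2"
    unfolding num_limit_cycles_def using card_mono[OF lift(1) step.hyps(3)] lift(2) by simp
  then have "num_limit_cycles (sep_pullback p X) * (n + 1)\<^sup>2
      \<le> (num_limit_cycles X * (n + 1)\<^sup>2) * (degree p)\<^sup>2"
    by (metis mult.assoc mult.commute mult_le_mono1)
  also have "\<dots> \<le> (num_limit_cycles X0 * (?N + 1)\<^sup>2) * (degree p)\<^sup>2"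
    using step.IH by (intro mult_right_mono) auto
  also have "\<dots> = num_limit_cycles X0 * (degree p * (?N + 1))\<^sup>2"
    by (simp only: power_mult_distrib ac_simps)
  \<comment> \<open>The truncated subtraction in \<open>degree p - 1\<close> is exact because
    \<open>2 \<le> degree p\<close>.\<close>
  also have "degree p * (?N + 1) = scheme_degree n (ps @ [p]) + 1"
    using step.hyps(2) by (simp add: algebra_simps)
  finally show ?case
    using finite_subset[OF step.hyps(3) lift(1)] by blast
qed

lemma replication_scheme_bound:
  assumes "replication_scheme X0 ps X" "finite (limit_cycles X0)"
  shows "real (num_limit_cycles X) \<le>
    real (num_limit_cycles X0) * ((real (scheme_degree n ps) + 1) / (real n + 1)) ^ 2"
proof -
  have "real (num_limit_cycles X * (n + 1)\<^sup>2)
      \<le> real (num_limit_cycles X0 * (scheme_degree n ps + 1)\<^sup>2)"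
    using replication_scheme_limit_cycles[OF assms] of_nat_le_iff by blast
  then show ?thesis
    by (simp add: power_divide pos_le_divide_eq add.commute)
qed

lemma replication_scheme_0: "replication_scheme 0 ps X \<Longrightarrow> X = 0"
  by (induction rule: replication_scheme.induct) (simp_all add: sep_pullback_0)

lemma replication_scheme_degree:
  assumes "replication_scheme X0 ps X" "X0 \<noteq> 0"
  shows "vf_degree X = scheme_degree (vf_degree X0) ps"
proof -
  \<comment> \<open>Nonvanishing joins the induction claim because the degree formula for the next
    pullback requires it.\<close>
  have "X \<noteq> 0 \<and> vf_degree X = scheme_degree (vf_degree X0) ps"
    using assms by (induction rule: replication_scheme.induct) (simp_all add: vf_degree_sep_pullback)
  then show ?thesis ..
qed

lemma vf_degree_0 [simp]: "vf_degree 0 = 0"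
  by (simp add: vf_degree_def)

text \<open>In the first part \<open>N\<close> is the nominal degree that starts from
  \<open>n0\<close>. With the actual degree of \<open>X\<close>, a field \<open>X0\<close> of degree
  below \<open>n0\<close> with \<open>k0 > 0\<close> would violate the bound already for the empty
  scheme. The growth statement in the second part uses the actual degree.\<close>

theorem theorem2:
  fixes n0 k0 :: nat
  assumes "1 \<le> n0"
  shows
    "(\<forall>X0 ps X N.
        vf_degree X0 \<le> n0 \<and> finite (limit_cycles X0) \<and> num_limit_cycles X0 = k0 \<and>
        replication_scheme X0 ps X \<and> N = scheme_degree n0 ps \<longrightarrow>
          vf_degree X \<le> N \<and> (vf_degree X0 = n0 \<longrightarrow> vf_degree X = N) \<and>
          finite (limit_cycles X) \<and>
          real (num_limit_cycles X) \<le> real k0 * ((real N + 1) / (real n0 + 1)) ^ 2) \<and>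
     (\<exists>C. \<forall>X0 ps X N.
        vf_degree X0 \<le> n0 \<and> finite (limit_cycles X0) \<and> num_limit_cycles X0 = k0 \<and>
        replication_scheme X0 ps X \<and> N = vf_degree X \<and> 1 \<le> N \<longrightarrow>
          real (num_limit_cycles X) \<le> C * real N ^ 2)"
proof (intro conjI allI impI exI[of _ "4 * real k0"]; elim conjE)
  fix X0 ps X N
  assume deg: "vf_degree X0 \<le> n0" and fin: "finite (limit_cycles X0)"
    and k0: "num_limit_cycles X0 = k0" and sch: "replication_scheme X0 ps X"
    and N: "N = scheme_degree n0 ps"
  show "vf_degree X \<le> N"
  proof (cases "X0 = 0")
    case True
    then have "X = 0" using replication_scheme_0 sch by blast
    then show ?thesis by simp
  next
    case False
    then show ?thesis
      using replication_scheme_degree[OF sch] scheme_degree_mono[OF deg] N by simp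
  qed
  show "vf_degree X = N" if "vf_degree X0 = n0"
  proof -
    \<comment> \<open>The zero field has degree 0, whereas \<open>1 \<le> n0\<close>.\<close>
    have "X0 \<noteq> 0" using that assms by auto
    then show ?thesis using replication_scheme_degree[OF sch] that N by simp
  qed
  show "finite (limit_cycles X)"
    using replication_scheme_limit_cycles[OF sch fin] by blast
  show "real (num_limit_cycles X) \<le> real k0 * ((real N + 1) / (real n0 + 1)) ^ 2"
    using replication_scheme_bound[OF sch fin] k0 N by blast
next
  fix X0 ps X N
  assume fin: "finite (limit_cycles X0)" and k0: "num_limit_cycles X0 = k0"
    and sch: "replication_scheme X0 ps X" and N: "N = vf_degree X" "1 \<le> N"
  \<comment> \<open>Starting the degree count at \<open>?m\<close> instead of \<open>n0\<close>
    makes the nominal degree equal to \<open>vf_degree X\<close>. The constant 4 then comes from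
    \<open>(N + 1) / (?m + 1) \<le> N + 1 \<le> 2 * N\<close>, squared.\<close>
  let ?m = "vf_degree X0"
  have "X \<noteq> 0" using N by auto
  then have "X0 \<noteq> 0" using replication_scheme_0 sch by blast
  then have "real (num_limit_cycles X) \<le> real k0 * ((real N + 1) / (real ?m + 1)) ^ 2"
    using replication_scheme_bound[OF sch fin, of ?m] replication_scheme_degree[OF sch] k0 N
    by simp
  also have "\<dots> \<le> real k0 * (2 * real N) ^ 2"
  proof -
    have "(real N + 1) / (real ?m + 1) \<le> (real N + 1) / 1"
      by (intro divide_left_mono) auto
    also have "\<dots> \<le> 2 * real N"
      using N(2) by simp
    finally show ?thesis
      by (intro mult_left_mono power_mono) auto
  qed
  finally show "real (num_limit_cycles X) \<le> 4 * real k0 * real N ^ 2"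
    by (simp add: power_mult_distrib)
qed

end
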